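(* Let $(\Omega,\Sigma,\mu)$ be a ($\sigma$-finite, complete) non-atomic separable measure space, and let $p$ be a measurable function on $\Omega$ with $1\le p(x)<\infty$ for a.a. $x\in\Omega$. The variable exponent Lebesgue space $L^{p(\cdot)}$ is uniformly convex if and only if $1<p^-\le p^+<\infty$.
   Context: $p^+=\operatorname{ess\,sup}_{x\in\Omega}p(x)$ and $p^-=\operatorname{ess\,inf}_{x\in\Omega}p(x)$. $L^{p(\cdot)}$ is the space $L^\Phi$ for $\Phi(x,t)=t^{p(x)}/p(x)$, i.e. the space of all (classes of) measurable functions $f:\Omega\to\mathbb C$ with $I_\Phi(\lambda f)=\int_\Omega\Phi(x,\lambda|f(x)|)\,d\mu(x)<\infty$ for some $\lambda>0$, with the Luxemburg norm $\|f\|_\Phi=\inf\{\lambda>0: I_\Phi(f/\lambda)\le1\}$. A measure $\mu$ is separable if the family of sets of finite measure with the distance $d(A,B)=\mu(A\triangle B)$ is separable. A Banach space $X$ with unit ball $B(X)$ is uniformly convex if for every $\epsilon\in(0,1)$ there is $\delta>0$ such that for all $x,y\in B(X)$, $\|x-y\|>\epsilon$ implies $\left\|\frac{x+y}{2}\right\|<1-\delta$. *)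

theory Defs
  imports "HOL-Probability.Essential_Supremum"
begin

definition essinf :: "'a measure \<Rightarrow> ('a \<Rightarrow> ereal) \<Rightarrow> ereal" where
  "essinf M f = Sup {z. AE x in M. z \<le> f x}"

definition non_atomic :: "'a measure \<Rightarrow> bool" where
  "non_atomic M \<longleftrightarrow>
     (\<forall>A\<in>sets M. 0 < emeasure M A \<longrightarrow>
        (\<exists>B\<in>sets M. B \<subseteq> A \<and> 0 < emeasure M B \<and> emeasure M B < emeasure M A))"

text \<open>Separability of the pseudometric \<open>d(A, B) = \<mu>(A \<triangle> B)\<close> on the sets of finite measure.\<close>

definition separable_measure :: "'a measure \<Rightarrow> bool" where
  "separable_measure M \<longleftrightarrow>
     (\<exists>D. countable D \<and> D \<subseteq> fmeasurable M \<and>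
        (\<forall>A\<in>fmeasurable M. \<forall>e>0. \<exists>B\<in>D. measure M (sym_diff A B) < e))"

subsection \<open>Uniform convexity\<close>

text \<open>The space \<open>L\<^sup>\<Phi>\<close> depends on a measure and on \<open>\<Phi>\<close> and is not a type, so the operations that
  enter the definition of uniform convexity are carried by a record. Only the operations are
  recorded; no axioms are imposed.\<close>

record 'v normed_structure =
  vectors :: "'v set"
  vadd :: "'v \<Rightarrow> 'v \<Rightarrow> 'v"
  vscale :: "complex \<Rightarrow> 'v \<Rightarrow> 'v"
  vnorm :: "'v \<Rightarrow> real"

definition unit_ball :: "('v, 'z) normed_structure_scheme \<Rightarrow> 'v set" where
  "unit_ball X = {x \<in> vectors X. vnorm X x \<le> 1}"

definition uniformly_convex :: "('v, 'z) normed_structure_scheme \<Rightarrow> bool" where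
  "uniformly_convex X \<longleftrightarrow>
     (\<forall>\<epsilon>. 0 < \<epsilon> \<and> \<epsilon> < 1 \<longrightarrow>
       (\<exists>\<delta>>0. \<forall>x\<in>unit_ball X. \<forall>y\<in>unit_ball X.
          vnorm X (vadd X x (vscale X (-1) y)) > \<epsilon> \<longrightarrow>
          vnorm X (vscale X (1/2) (vadd X x y)) < 1 - \<delta>))"

subsection \<open>The space \<open>L\<^sup>\<Phi>\<close>\<close>

definition modular :: "'a measure \<Rightarrow> ('a \<Rightarrow> real \<Rightarrow> real) \<Rightarrow> ('a \<Rightarrow> complex) \<Rightarrow> ennreal" where
  "modular M \<Phi> f = (\<integral>\<^sup>+ x. ennreal (\<Phi> x (cmod (f x))) \<partial>M)"

definition orlicz_functions :: "'a measure \<Rightarrow> ('a \<Rightarrow> real \<Rightarrow> real) \<Rightarrow> ('a \<Rightarrow> complex) set" where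
  "orlicz_functions M \<Phi> =
     {f \<in> borel_measurable M. \<exists>l::real. l > 0 \<and> modular M \<Phi> (\<lambda>x. of_real l * f x) < \<infinity>}"

definition luxemburg_norm :: "'a measure \<Rightarrow> ('a \<Rightarrow> real \<Rightarrow> real) \<Rightarrow> ('a \<Rightarrow> complex) \<Rightarrow> real" where
  "luxemburg_norm M \<Phi> f =
     Inf {l::real. l > 0 \<and> modular M \<Phi> (\<lambda>x. f x / of_real l) \<le> 1}"

definition ae_rel :: "'a measure \<Rightarrow> (('a \<Rightarrow> complex) \<times> ('a \<Rightarrow> complex)) set" where
  "ae_rel M = {(f, g). f \<in> borel_measurable M \<and> g \<in> borel_measurable M \<and> (AE x in M. f x = g x)}"

text \<open>Elements of \<open>L\<^sup>\<Phi>\<close> are classes of functions modulo a.e. equality. The operations and the norm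
  are computed on representatives; the lemmas below show that the choice does not matter.\<close>

definition orlicz_space ::
    "'a measure \<Rightarrow> ('a \<Rightarrow> real \<Rightarrow> real) \<Rightarrow> ('a \<Rightarrow> complex) set normed_structure" where
  "orlicz_space M \<Phi> =
     \<lparr> vectors = orlicz_functions M \<Phi> // ae_rel M,
       vadd = (\<lambda>F G. ae_rel M `` {(\<lambda>x. f x + g x) | f g. f \<in> F \<and> g \<in> G}),
       vscale = (\<lambda>c F. ae_rel M `` {(\<lambda>x. c * f x) | f. f \<in> F}),
       vnorm = (\<lambda>F. the_elem (luxemburg_norm M \<Phi> ` F)) \<rparr>"

lemma equiv_ae_rel: "equiv (borel_measurable M) (ae_rel M)"
proof (rule equivI)
  show "ae_rel M \<subseteq> borel_measurable M \<times> borel_measurable M"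
    by (auto simp: ae_rel_def)
  show "refl_on (borel_measurable M) (ae_rel M)"
    by (auto simp: ae_rel_def refl_on_def)
  show "sym (ae_rel M)"
    by (auto simp: ae_rel_def sym_def eq_commute)
  show "trans (ae_rel M)"
  proof (rule transI)
    fix f g h assume fg: "(f, g) \<in> ae_rel M" and gh: "(g, h) \<in> ae_rel M"
    from fg have 1: "AE x in M. f x = g x" by (simp add: ae_rel_def)
    from gh have 2: "AE x in M. g x = h x" by (simp add: ae_rel_def)
    from 1 2 have "AE x in M. f x = h x" by eventually_elim simp
    with fg gh show "(f, h) \<in> ae_rel M" by (simp add: ae_rel_def)
  qed
qed

lemma modular_cong_AE:
  assumes "AE x in M. f x = g x"
  shows "modular M \<Phi> f = modular M \<Phi> g"
  unfolding modular_def by (rule nn_integral_cong_AE) (use assms in eventually_elim, simp)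

lemma luxemburg_norm_cong_AE:
  assumes "AE x in M. f x = g x"
  shows "luxemburg_norm M \<Phi> f = luxemburg_norm M \<Phi> g"
proof -
  have "modular M \<Phi> (\<lambda>x. f x / of_real l) = modular M \<Phi> (\<lambda>x. g x / of_real l)" for l
    by (rule modular_cong_AE) (use assms in eventually_elim, simp)
  then show ?thesis by (simp add: luxemburg_norm_def)
qed

lemma orlicz_functions_cong_AE:
  assumes "(f, g) \<in> ae_rel M"
  shows "f \<in> orlicz_functions M \<Phi> \<longleftrightarrow> g \<in> orlicz_functions M \<Phi>"
proof -
  have "AE x in M. f x = g x" using assms by (simp add: ae_rel_def)
  then have "AE x in M. of_real l * f x = of_real l * g x" for l :: real
    by eventually_elim simp
  then have "modular M \<Phi> (\<lambda>x. of_real l * f x) = modular M \<Phi> (\<lambda>x. of_real l * g x)" for l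
    by (rule modular_cong_AE)
  then show ?thesis using assms by (simp add: orlicz_functions_def ae_rel_def)
qed

lemma vnorm_orlicz_class:
  assumes "f \<in> borel_measurable M"
  shows "vnorm (orlicz_space M \<Phi>) (ae_rel M `` {f}) = luxemburg_norm M \<Phi> f"
proof -
  have "luxemburg_norm M \<Phi> g = luxemburg_norm M \<Phi> f" if "(f, g) \<in> ae_rel M" for g
    using that luxemburg_norm_cong_AE[of f g M \<Phi>] by (simp add: ae_rel_def)
  moreover have "(f, f) \<in> ae_rel M" using assms by (simp add: ae_rel_def)
  ultimately have "luxemburg_norm M \<Phi> ` (ae_rel M `` {f}) = {luxemburg_norm M \<Phi> f}"
    by blast
  then show ?thesis by (simp add: orlicz_space_def)
qed

lemma vadd_orlicz_class:
  assumes "f \<in> borel_measurable M" "g \<in> borel_measurable M"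
  shows "vadd (orlicz_space M \<Phi>) (ae_rel M `` {f}) (ae_rel M `` {g}) =
    ae_rel M `` {\<lambda>x. f x + g x}"
proof -
  let ?S = "{(\<lambda>x. f' x + g' x) | f' g'. f' \<in> ae_rel M `` {f} \<and> g' \<in> ae_rel M `` {g}}"
  have "(\<lambda>x. f x + g x, \<lambda>x. f' x + g' x) \<in> ae_rel M"
    if f': "(f, f') \<in> ae_rel M" and g': "(g, g') \<in> ae_rel M" for f' g'
  proof -
    have "AE x in M. f x = f' x" "AE x in M. g x = g' x"
      using f' g' by (simp_all add: ae_rel_def)
    then have "AE x in M. f x + g x = f' x + g' x" by eventually_elim simp
    then show ?thesis using f' g' by (simp add: ae_rel_def borel_measurable_add)
  qed
  then have "?S \<subseteq> ae_rel M `` {\<lambda>x. f x + g x}" by blast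
  moreover have "(\<lambda>x. f x + g x) \<in> ?S"
    using assms by (auto simp: ae_rel_def)
  ultimately have "ae_rel M `` ?S = ae_rel M `` {\<lambda>x. f x + g x}"
    using equiv_ae_rel[of M] unfolding equiv_def trans_def by blast
  then show ?thesis by (simp add: orlicz_space_def)
qed

lemma vscale_orlicz_class:
  assumes "f \<in> borel_measurable M"
  shows "vscale (orlicz_space M \<Phi>) c (ae_rel M `` {f}) = ae_rel M `` {\<lambda>x. c * f x}"
proof -
  let ?S = "{(\<lambda>x. c * f' x) | f'. f' \<in> ae_rel M `` {f}}"
  have "(\<lambda>x. c * f x, \<lambda>x. c * f' x) \<in> ae_rel M" if f': "(f, f') \<in> ae_rel M" for f'
  proof -
    have "AE x in M. f x = f' x" using f' by (simp add: ae_rel_def)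
    then have "AE x in M. c * f x = c * f' x" by eventually_elim simp
    then show ?thesis using f' by (simp add: ae_rel_def borel_measurable_times)
  qed
  then have "?S \<subseteq> ae_rel M `` {\<lambda>x. c * f x}" by blast
  moreover have "(\<lambda>x. c * f x) \<in> ?S"
    using assms by (auto simp: ae_rel_def)
  ultimately have "ae_rel M `` ?S = ae_rel M `` {\<lambda>x. c * f x}"
    using equiv_ae_rel[of M] unfolding equiv_def trans_def by blast
  then show ?thesis by (simp add: orlicz_space_def)
qed

subsection \<open>Variable exponent Lebesgue spaces\<close>

text \<open>The exponent is extended-real valued, as it is only required to be finite almost everywhere;
  \<^const>\<open>real_of_ereal\<close> only alters it on the exceptional null set. Note \<open>0 powr a = 0\<close>.\<close>

definition var_exp_phi :: "('a \<Rightarrow> ereal) \<Rightarrow> 'a \<Rightarrow> real \<Rightarrow> real" where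
  "var_exp_phi p x t = t powr real_of_ereal (p x) / real_of_ereal (p x)"

definition var_exp_lebesgue ::
    "'a measure \<Rightarrow> ('a \<Rightarrow> ereal) \<Rightarrow> ('a \<Rightarrow> complex) set normed_structure" where
  "var_exp_lebesgue M p = orlicz_space M (var_exp_phi p)"

end

theory Submission
  imports Defs
begin

text \<open>
  Write \<open>q x\<close> for the real exponent and \<open>\<rho> f = \<integral> \<bar>f\<bar>\<^sup>q / q\<close> for the modular, so that the
  Luxemburg norm is the gauge of \<open>{f. \<rho> f \<le> 1}\<close>.

  Suppose \<open>1 < a \<le> q \<le> b < \<infinity>\<close> almost everywhere. For exponents in the compact interval \<open>[a, b]\<close> the
  strict convexity of \<open>\<bar>\<sqdot>\<bar>\<^sup>q\<close> on the complex plane is uniform. In integrated form this says that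
  \<open>\<rho> ((f + g) / 2)\<close> lies below the mean of \<open>\<rho> f\<close> and \<open>\<rho> g\<close> by a fixed multiple of \<open>\<rho> (f - g)\<close>, up to an
  error that can be chosen small beforehand (\<open>powr_norm_uniformly_convex\<close>). Because the exponents are
  bounded, multiplying \<open>f\<close> by \<open>c\<close> changes \<open>\<rho> f\<close> by a factor between fixed powers of \<open>c\<close>; hence a lower
  bound on the norm of \<open>f - g\<close> is a lower bound on \<open>\<rho> (f - g)\<close>, and \<open>\<rho> h \<le> 1 - \<kappa>\<close> gives a norm of
  \<open>h\<close> that is smaller than 1 by a fixed amount (\<open>uniformly_convex_if_exponent_bounds\<close>).

  Conversely, a non-atomic \<open>\<sigma>\<close>-finite measure provides, inside every set of positive measure, two
  disjoint sets of finite positive measure, and each of them carries a function of modular 1.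
  Call these functions \<open>e\<close> and \<open>f\<close>.
  Where \<open>q\<close> is large they span nearly a two-dimensional \<open>\<ell>\<^sup>\<infinity>\<close>: the functions \<open>c (e + f)\<close> and
  \<open>c (e - f)\<close> lie in the unit ball for some \<open>c\<close> close to 1, and their midpoint \<open>c e\<close> has norm at
  least \<open>c\<close> (\<open>not_uniformly_convex_if_exponent_unbounded\<close>). Where \<open>q\<close> is close to 1 they span nearly a
  two-dimensional \<open>\<ell>\<^sup>1\<close>: the midpoint of \<open>e\<close> and \<open>f\<close> has norm close to 1
  (\<open>not_uniformly_convex_if_exponent_near_1\<close>). So if either bound on the exponent fails, there are pairs
  of points of the unit ball, more than \<open>1/2\<close> apart, whose midpoints come arbitrarily close to the
  unit sphere.
\<close>

section \<open>A uniform convexity inequality for powers\<close>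

text \<open>With \<open>m\<close> the midpoint, the function \<open>x \<mapsto> (m + x)\<^sup>q + (m - x)\<^sup>q\<close> is strictly increasing, since the
  derivative of \<open>x\<^sup>q\<close> is.\<close>

lemma powr_strict_midpoint_convex:
  fixes s t q :: real
  assumes "0 \<le> s" "0 \<le> t" "s \<noteq> t" "1 < q"
  shows "((s + t) / 2) powr q < (s powr q + t powr q) / 2"
proof -
  define m where "m = (s + t) / 2"
  define d where "d = \<bar>s - t\<bar> / 2"
  have d: "0 < d" "d \<le> m" using assms by (auto simp: m_def d_def)
  have "(m + 0) powr q + (m - 0) powr q < (m + d) powr q + (m - d) powr q"
  proof (rule DERIV_pos_imp_increasing_open[OF d(1)])
    fix x assume x: "0 < x" "x < d"
    have "((\<lambda>x. (m + x) powr q + (m - x) powr q) has_real_derivative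
        q * (m + x) powr (q - 1) - q * (m - x) powr (q - 1)) (at x)"
      using x d by (auto intro!: derivative_eq_intros simp: powr_diff field_simps)
    moreover have "(m - x) powr (q - 1) < (m + x) powr (q - 1)"
      using x d assms by (intro powr_less_mono2) auto
    ultimately show "\<exists>y. ((\<lambda>x. (m + x) powr q + (m - x) powr q) has_real_derivative y) (at x)
        \<and> 0 < y"
      using assms by (intro exI conjI) auto
  next
    show "continuous_on {0..d} (\<lambda>x. (m + x) powr q + (m - x) powr q)"
      using d assms by (intro continuous_on_add continuous_on_powr' continuous_intros) auto
  qed
  moreover have "{m + d, m - d} = {s, t}" "(m + d) powr q + (m - d) powr q = s powr q + t powr q"
    by (auto simp: m_def d_def abs_if field_simps)
  ultimately show ?thesis by (simp add: m_def)
qed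

text \<open>If the moduli differ, the strict convexity of \<open>t\<^sup>q\<close> on the half-line makes the inequality strict.
  If they agree, \<open>u\<close> and \<open>v\<close> are not positive multiples of each other, so the triangle inequality is
  strict.\<close>

lemma powr_norm_strict_midpoint_convex:
  fixes u v :: complex
  assumes "u \<noteq> v" "1 < q"
  shows "cmod ((u + v) / 2) powr q < (cmod u powr q + cmod v powr q) / 2"
proof (cases "cmod u = cmod v")
  case True
  have "cmod (u + v) \<noteq> cmod u + cmod v"
    using True assms norm_triangle_eq[of u v] by auto
  then have "cmod ((u + v) / 2) < cmod u"
    using norm_triangle_ineq[of u v] True by (simp add: norm_divide)
  then have "cmod ((u + v) / 2) powr q < cmod u powr q"
    using assms by (intro powr_less_mono2) auto
  then show ?thesis using True by simp
next
  case False
  have "cmod ((u + v) / 2) powr q \<le> ((cmod u + cmod v) / 2) powr q"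
    using assms norm_triangle_ineq[of u v] by (intro powr_mono2) (auto simp: norm_divide)
  also have "\<dots> < (cmod u powr q + cmod v powr q) / 2"
    using False assms by (intro powr_strict_midpoint_convex) auto
  finally show ?thesis .
qed

text \<open>All terms are homogeneous of degree \<open>q\<close> in \<open>(u, v)\<close>, so one may assume that the larger modulus
  is 1; then \<open>(u, v, q)\<close> ranges over a compact set \<open>K\<close>. On the compact part \<open>K'\<close> where \<open>\<bar>u - v\<bar>\<^sup>q\<close> is not
  negligible the convexity gap \<open>G\<close> is positive, hence at least some \<open>m > 0\<close>; elsewhere the term with
  the factor \<open>c\<close> has the favourable sign. The inequality has no side condition on \<open>u - v\<close>, and so
  it can be integrated directly; the price is the error term with the prescribed \<open>\<eta>\<close>.\<close>

lemma powr_norm_uniformly_convex: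
  assumes "1 < a" "0 < \<eta>"
  obtains c where "0 < c"
    "\<And>u v q. a \<le> q \<Longrightarrow> q \<le> b \<Longrightarrow>
       cmod ((u + v) / 2) powr q + c * cmod (u - v) powr q
         \<le> (1/2 + c * \<eta>) * (cmod u powr q + cmod v powr q)"
proof -
  define S where "S = (\<lambda>(u, v, q). cmod u powr q + cmod v powr q)"
  define D where "D = (\<lambda>(u, v, q). cmod (u - v) powr q)"
  define G where "G = (\<lambda>(u, v, q). (cmod u powr q + cmod v powr q) / 2 - cmod ((u + v) / 2) powr q)"
  define K where "K = {(u, v, q). cmod u \<le> 1 \<and> cmod v \<le> 1 \<and> 1 \<le> max (cmod u) (cmod v)
                        \<and> a \<le> q \<and> q \<le> b}"
  define K' where "K' = {z \<in> K. \<eta> * S z \<le> D z}"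
  have "K = (cball 0 1 \<times> cball 0 1 \<times> {a..b}) \<inter> {z. 1 \<le> max (cmod (fst z)) (cmod (fst (snd z)))}"
    by (auto simp: K_def)
  moreover have "closed {z :: complex \<times> complex \<times> real. 1 \<le> max (cmod (fst z)) (cmod (fst (snd z)))}"
    by (intro closed_Collect_le continuous_intros)
  ultimately have "compact K"
    by (auto intro!: compact_Int_closed compact_Times)
  have q_pos: "0 < snd (snd z)" if "z \<in> K" for z
    using that assms by (auto simp: K_def)
  have cont: "continuous_on K S" "continuous_on K D" "continuous_on K G"
    unfolding S_def D_def G_def case_prod_beta
    by (intro continuous_on_add continuous_on_diff continuous_on_divide continuous_on_powr'
        continuous_intros ballI conjI impI; use q_pos in auto)+
  have "compact K'"
  proof -
    have "closedin (top_of_set K) (K \<inter> (\<lambda>z. D z - \<eta> * S z) -` {0..})"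
      by (intro continuous_closedin_preimage continuous_intros cont)
    moreover have "K' = K \<inter> (\<lambda>z. D z - \<eta> * S z) -` {0..}" by (auto simp: K'_def)
    ultimately show ?thesis using \<open>compact K\<close> closedin_compact by metis
  qed
  have G_pos: "0 < G z" if z: "z \<in> K'" for z
  proof -
    obtain u v q where [simp]: "z = (u, v, q)" by (cases z)
    have uv: "u \<noteq> 0 \<or> v \<noteq> 0" "1 < q" using z assms by (auto simp: K'_def K_def)
    then have "0 < S z" by (auto simp: S_def add_nonneg_pos add_pos_nonneg)
    then have "0 < \<eta> * S z" using assms by simp
    then have "0 < D z" using z by (auto simp: K'_def)
    then have "u \<noteq> v" by (auto simp: D_def)
    then show ?thesis
      using powr_norm_strict_midpoint_convex[of u v q] uv by (simp add: G_def)
  qed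
  obtain m where m: "0 < m" "\<And>z. z \<in> K' \<Longrightarrow> m \<le> G z"
  proof (cases "K' = {}")
    case False
    have "continuous_on K' G" using cont(3) by (rule continuous_on_subset) (auto simp: K'_def)
    from continuous_attains_inf[OF \<open>compact K'\<close> False this] show ?thesis
      using G_pos that by metis
  qed (use that[of 1] in auto)
  \<comment> \<open>On \<open>K\<close> the difference \<open>\<bar>u - v\<bar>\<close> is at most 2, so \<open>D\<close> is at most \<open>2\<^sup>b\<close> and \<open>c D\<close> at most \<open>m\<close>.\<close>
  define c where "c = m / 2 powr b"
  have c: "0 < c" using m by (simp add: c_def)
  have normalised: "c * (D z - \<eta> * S z) \<le> G z" if z: "z \<in> K" for z
  proof -
    obtain u v q where [simp]: "z = (u, v, q)" by (cases z)
    have uv: "cmod u \<le> 1" "cmod v \<le> 1" "1 < q" "q \<le> b" using z assms by (auto simp: K_def)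
    show ?thesis
    proof (cases "z \<in> K'")
      case True
      have "D z \<le> 2 powr q"
        unfolding D_def using uv norm_triangle_ineq4[of u v] by (auto intro!: powr_mono2)
      also have "\<dots> \<le> 2 powr b" using uv by (intro powr_mono) auto
      finally have "D z \<le> 2 powr b" .
      moreover have "0 \<le> \<eta> * S z" using assms by (auto simp: S_def)
      ultimately have "c * (D z - \<eta> * S z) \<le> c * 2 powr b"
        using c by (intro mult_left_mono) auto
      also have "\<dots> = m" by (simp add: c_def)
      finally show ?thesis using m(2)[OF True] by simp
    next
      case False
      then have "c * (D z - \<eta> * S z) \<le> 0"
        using z c by (auto simp: K'_def mult_nonneg_nonpos)
      also have "0 \<le> G z"
        using powr_norm_strict_midpoint_convex[of u v q] uv by (cases "u = v") (auto simp: G_def)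
      finally show ?thesis .
    qed
  qed
  show ?thesis
  proof (rule that[OF c])
    fix u v :: complex and q :: real
    assume q: "a \<le> q" "q \<le> b"
    define t where "t = max (cmod u) (cmod v)"
    show "cmod ((u + v) / 2) powr q + c * cmod (u - v) powr q
         \<le> (1/2 + c * \<eta>) * (cmod u powr q + cmod v powr q)"
    proof (cases "t = 0")
      case True
      then have "cmod u \<le> 0" "cmod v \<le> 0" unfolding t_def by linarith+
      then show ?thesis by simp
    next
      case False
      then have t: "0 < t" by (auto simp: t_def less_max_iff_disj)
      define u' v' where "u' = u / of_real t" and "v' = v / of_real t"
      have uv: "u = of_real t * u'" "v = of_real t * v'" using t by (auto simp: u'_def v'_def)
      have le: "cmod u \<le> t" "cmod v \<le> t" "t \<le> max (cmod u) (cmod v)" by (auto simp: t_def)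
      have "(u', v', q) \<in> K"
        using le t q by (auto simp: K_def u'_def v'_def norm_divide le_max_iff_disj)
      from normalised[OF this]
      have "cmod ((u' + v') / 2) powr q + c * cmod (u' - v') powr q
          \<le> (1/2 + c * \<eta>) * (cmod u' powr q + cmod v' powr q)"
        by (simp add: S_def D_def G_def algebra_simps)
      then have "t powr q * (cmod ((u' + v') / 2) powr q + c * cmod (u' - v') powr q)
          \<le> t powr q * ((1/2 + c * \<eta>) * (cmod u' powr q + cmod v' powr q))"
        by (intro mult_left_mono) auto
      moreover have "cmod u powr q = t powr q * cmod u' powr q"
        "cmod v powr q = t powr q * cmod v' powr q"
        using t by (auto simp: uv norm_mult powr_mult)
      moreover have "cmod (u - v) powr q = t powr q * cmod (u' - v') powr q"
        using t by (simp add: uv norm_mult powr_mult flip: right_diff_distrib)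
      moreover have "cmod ((u + v) / 2) powr q = t powr q * cmod ((u' + v') / 2) powr q"
      proof -
        have "(u + v) / 2 = of_real t * ((u' + v') / 2)" by (simp add: uv field_simps)
        then have "cmod ((u + v) / 2) = t * cmod ((u' + v') / 2)"
          using t by (simp only: norm_mult) simp
        then show ?thesis using t by (simp only: powr_mult norm_ge_zero)
      qed
      ultimately show ?thesis by (simp add: algebra_simps)
    qed
  qed
qed

section \<open>The modular and the Luxemburg norm\<close>

lemma uniformly_convex_orlicz_space_iff:
  "uniformly_convex (orlicz_space M \<Phi>) \<longleftrightarrow>
     (\<forall>\<epsilon>. 0 < \<epsilon> \<and> \<epsilon> < 1 \<longrightarrow>
       (\<exists>\<delta>>0. \<forall>f\<in>orlicz_functions M \<Phi>. \<forall>g\<in>orlicz_functions M \<Phi>.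
          luxemburg_norm M \<Phi> f \<le> 1 \<longrightarrow> luxemburg_norm M \<Phi> g \<le> 1 \<longrightarrow>
          luxemburg_norm M \<Phi> (\<lambda>x. f x - g x) > \<epsilon> \<longrightarrow>
          luxemburg_norm M \<Phi> (\<lambda>x. (f x + g x) / 2) < 1 - \<delta>))"
proof -
  let ?X = "orlicz_space M \<Phi>"
  have ball: "unit_ball ?X = (\<lambda>f. ae_rel M `` {f}) `
      {f \<in> orlicz_functions M \<Phi>. luxemburg_norm M \<Phi> f \<le> 1}"
    using vnorm_orlicz_class[of _ M \<Phi>]
    by (force simp: unit_ball_def orlicz_space_def quotient_def orlicz_functions_def)
  have norms:
    "vnorm ?X (vadd ?X (ae_rel M `` {f}) (vscale ?X (-1) (ae_rel M `` {g}))) =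
       luxemburg_norm M \<Phi> (\<lambda>x. f x - g x)"
    "vnorm ?X (vscale ?X (1/2) (vadd ?X (ae_rel M `` {f}) (ae_rel M `` {g}))) =
       luxemburg_norm M \<Phi> (\<lambda>x. (f x + g x) / 2)"
    if "f \<in> orlicz_functions M \<Phi>" "g \<in> orlicz_functions M \<Phi>" for f g
  proof -
    have [measurable]: "f \<in> borel_measurable M" "g \<in> borel_measurable M"
      using that by (auto simp: orlicz_functions_def)
    show "vnorm ?X (vadd ?X (ae_rel M `` {f}) (vscale ?X (-1) (ae_rel M `` {g}))) =
       luxemburg_norm M \<Phi> (\<lambda>x. f x - g x)"
      by (subst vscale_orlicz_class, simp, subst vadd_orlicz_class, simp, simp,
          subst vnorm_orlicz_class) simp_all
    show "vnorm ?X (vscale ?X (1/2) (vadd ?X (ae_rel M `` {f}) (ae_rel M `` {g}))) =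
       luxemburg_norm M \<Phi> (\<lambda>x. (f x + g x) / 2)"
      by (subst vadd_orlicz_class, simp, simp, subst vscale_orlicz_class, simp,
          subst vnorm_orlicz_class) simp_all
  qed
  show ?thesis
    unfolding uniformly_convex_def ball by (simp add: norms) (simp add: Ball_def imp_conjL)
qed

lemma one_le_real_of_ereal:
  fixes q :: ereal
  assumes "1 \<le> q" "q < \<infinity>"
  shows "1 \<le> real_of_ereal q"
  using assms by (cases q) auto

lemma borel_measurable_var_exp_phi [measurable]:
  assumes [measurable]: "p \<in> borel_measurable M" "f \<in> borel_measurable M"
  shows "(\<lambda>x. var_exp_phi p x (f x)) \<in> borel_measurable M"
  unfolding var_exp_phi_def by measurable

lemma luxemburg_norm_le:
  assumes "0 < l" "modular M \<Phi> (\<lambda>x. f x / of_real l) \<le> 1"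
  shows "luxemburg_norm M \<Phi> f \<le> l"
  unfolding luxemburg_norm_def using assms by (intro cInf_lower bdd_belowI[of _ 0]) auto

text \<open>The next two facts bound the modular of a multiple of \<open>f\<close>. The exponent is only constrained
  where \<open>f\<close> is nonzero: for functions concentrated where the exponent is large or close to 1 they are
  much sharper than what holds for all functions.\<close>

lemma modular_scale_le:
  assumes [measurable]: "p \<in> borel_measurable M" "f \<in> borel_measurable M"
    and "0 \<le> k" "0 \<le> c"
    and ae: "AE x in M. f x \<noteq> 0 \<longrightarrow> 1 \<le> real_of_ereal (p x) \<and> c powr real_of_ereal (p x) \<le> k"
  shows "modular M (var_exp_phi p) (\<lambda>x. of_real c * f x)
    \<le> ennreal k * modular M (var_exp_phi p) f"
proof -
  have "modular M (var_exp_phi p) (\<lambda>x. of_real c * f x)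
      \<le> (\<integral>\<^sup>+ x. ennreal k * ennreal (var_exp_phi p x (cmod (f x))) \<partial>M)"
    unfolding modular_def
  proof (rule nn_integral_mono_AE, use ae in eventually_elim)
    fix x assume *: "f x \<noteq> 0 \<longrightarrow> 1 \<le> real_of_ereal (p x) \<and> c powr real_of_ereal (p x) \<le> k"
    show "ennreal (var_exp_phi p x (cmod (of_real c * f x)))
        \<le> ennreal k * ennreal (var_exp_phi p x (cmod (f x)))"
      using * assms(3,4) by (cases "f x = 0")
        (auto simp: var_exp_phi_def norm_mult powr_mult divide_right_mono mult_right_mono
              simp flip: ennreal_mult intro!: ennreal_leI)
  qed
  also have "\<dots> = ennreal k * modular M (var_exp_phi p) f"
    unfolding modular_def by (rule nn_integral_cmult) measurable
  finally show ?thesis .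
qed

lemma modular_scale_ge:
  assumes [measurable]: "p \<in> borel_measurable M" "f \<in> borel_measurable M"
    and "0 \<le> k" "0 \<le> c"
    and ae: "AE x in M. f x \<noteq> 0 \<longrightarrow> 1 \<le> real_of_ereal (p x) \<and> k \<le> c powr real_of_ereal (p x)"
  shows "ennreal k * modular M (var_exp_phi p) f
    \<le> modular M (var_exp_phi p) (\<lambda>x. of_real c * f x)"
proof -
  have "ennreal k * modular M (var_exp_phi p) f
      = (\<integral>\<^sup>+ x. ennreal k * ennreal (var_exp_phi p x (cmod (f x))) \<partial>M)"
    unfolding modular_def by (rule nn_integral_cmult[symmetric]) measurable
  also have "\<dots> \<le> modular M (var_exp_phi p) (\<lambda>x. of_real c * f x)"
    unfolding modular_def
  proof (rule nn_integral_mono_AE, use ae in eventually_elim)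
    fix x assume *: "f x \<noteq> 0 \<longrightarrow> 1 \<le> real_of_ereal (p x) \<and> k \<le> c powr real_of_ereal (p x)"
    show "ennreal k * ennreal (var_exp_phi p x (cmod (f x)))
        \<le> ennreal (var_exp_phi p x (cmod (of_real c * f x)))"
      using * assms(3,4) by (cases "f x = 0")
        (auto simp: var_exp_phi_def norm_mult powr_mult divide_right_mono mult_right_mono
              simp flip: ennreal_mult intro!: ennreal_leI)
  qed
  finally show ?thesis .
qed

lemma modular_superhomogeneous:
  assumes "p \<in> borel_measurable M" "f \<in> borel_measurable M"
    and "AE x in M. 1 \<le> real_of_ereal (p x)" "1 \<le> c"
  shows "ennreal c * modular M (var_exp_phi p) f
    \<le> modular M (var_exp_phi p) (\<lambda>x. of_real c * f x)"
proof (rule modular_scale_ge)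
  show "AE x in M. f x \<noteq> 0 \<longrightarrow> 1 \<le> real_of_ereal (p x) \<and> c \<le> c powr real_of_ereal (p x)"
    using assms(3) by eventually_elim (use assms(4) powr_mono[of 1 _ c] in auto)
qed (use assms in auto)

text \<open>The Luxemburg norm is an infimum of reals, which is meaningful only for a nonempty set. Finiteness
  of the modular at one multiple of \<open>f\<close> suffices, because exponents of at least 1 let the modular
  decrease at least linearly when \<open>f\<close> is shrunk.\<close>

lemma luxemburg_norm_set_nonempty:
  assumes "p \<in> borel_measurable M" "f \<in> orlicz_functions M (var_exp_phi p)"
    and ae: "AE x in M. 1 \<le> real_of_ereal (p x)"
  shows "\<exists>l>0. modular M (var_exp_phi p) (\<lambda>x. f x / of_real l) \<le> 1"
proof -
  let ?\<rho> = "modular M (var_exp_phi p)"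
  have f: "f \<in> borel_measurable M" using assms by (auto simp: orlicz_functions_def)
  obtain l where l: "0 < l" "?\<rho> (\<lambda>x. of_real l * f x) < \<infinity>"
    using assms by (auto simp: orlicz_functions_def)
  then obtain K where K: "?\<rho> (\<lambda>x. of_real l * f x) = ennreal K" "0 \<le> K"
    by (cases "?\<rho> (\<lambda>x. of_real l * f x)") auto
  define c where "c = max 1 K"
  have c: "1 \<le> c" "K \<le> c" by (auto simp: c_def)
  have "ennreal c * ?\<rho> (\<lambda>x. f x / of_real (c / l)) \<le> ?\<rho> (\<lambda>x. of_real c * (f x / of_real (c / l)))"
    using f assms c by (intro modular_superhomogeneous) auto
  also have "(\<lambda>x. of_real c * (f x / of_real (c / l))) = (\<lambda>x. of_real l * f x)"
    using c l by (auto simp: field_simps)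
  also have "?\<rho> \<dots> \<le> ennreal c" using K c by (simp add: ennreal_leI)
  finally have "ennreal c * ?\<rho> (\<lambda>x. f x / of_real (c / l)) \<le> ennreal c * 1" by simp
  then have "?\<rho> (\<lambda>x. f x / of_real (c / l)) \<le> 1"
    using c by (subst (asm) ennreal_mult_le_mult_iff) auto
  then show ?thesis using c l by (intro exI[of _ "c / l"]) auto
qed

text \<open>If \<open>l < c\<close>, then \<open>f / l\<close> exceeds \<open>f / c\<close> by the factor \<open>c / l > 1\<close>, and superhomogeneity pushes its modular
  strictly above 1.\<close>

lemma luxemburg_norm_ge:
  assumes "p \<in> borel_measurable M" "f \<in> orlicz_functions M (var_exp_phi p)"
    and ae: "AE x in M. 1 \<le> real_of_ereal (p x)"
    and c: "0 < c" "1 \<le> modular M (var_exp_phi p) (\<lambda>x. f x / of_real c)"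
  shows "c \<le> luxemburg_norm M (var_exp_phi p) f"
  unfolding luxemburg_norm_def
proof (rule cInf_greatest)
  let ?\<rho> = "modular M (var_exp_phi p)"
  have f: "f \<in> borel_measurable M" using assms by (auto simp: orlicz_functions_def)
  show "{l. 0 < l \<and> ?\<rho> (\<lambda>x. f x / complex_of_real l) \<le> 1} \<noteq> {}"
    using luxemburg_norm_set_nonempty[OF assms(1-3)] by auto
  fix l assume "l \<in> {l. 0 < l \<and> ?\<rho> (\<lambda>x. f x / complex_of_real l) \<le> 1}"
  then have l: "0 < l" "?\<rho> (\<lambda>x. f x / complex_of_real l) \<le> 1" by auto
  show "c \<le> l"
  proof (rule ccontr)
    assume "\<not> c \<le> l"
    then have cl: "1 < c / l" using l by auto
    have "ennreal (c / l) * 1 \<le> ennreal (c / l) * ?\<rho> (\<lambda>x. f x / of_real c)"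
      using c by (intro mult_left_mono) auto
    also have "\<dots> \<le> ?\<rho> (\<lambda>x. of_real (c / l) * (f x / of_real c))"
      using f assms cl by (intro modular_superhomogeneous) auto
    also have "(\<lambda>x. of_real (c / l) * (f x / of_real c)) = (\<lambda>x. f x / of_real l)"
      using c by auto
    also note l(2)
    finally show False using cl by (simp add: ennreal_le_1)
  qed
qed

lemma orlicz_functionsI:
  assumes "f \<in> borel_measurable M" "modular M \<Phi> f < \<infinity>"
  shows "f \<in> orlicz_functions M \<Phi>"
  unfolding orlicz_functions_def using assms by (auto intro!: exI[of _ 1])


lemma modular_add_disjoint:
  assumes [measurable]: "p \<in> borel_measurable M" "f \<in> borel_measurable M" "g \<in> borel_measurable M"
    and disj: "\<And>x. f x = 0 \<or> g x = 0"
  shows "modular M (var_exp_phi p) (\<lambda>x. f x + g x)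
    = modular M (var_exp_phi p) f + modular M (var_exp_phi p) g"
proof -
  have "ennreal (var_exp_phi p x (cmod (f x + g x)))
      = ennreal (var_exp_phi p x (cmod (f x))) + ennreal (var_exp_phi p x (cmod (g x)))" for x
    using disj[of x] by (auto simp: var_exp_phi_def)
  then show ?thesis unfolding modular_def by (simp add: nn_integral_add)
qed

section \<open>Bounded exponents give a uniformly convex space\<close>

text \<open>For \<open>f\<close> and \<open>g\<close> in the unit ball at distance more than \<open>\<epsilon>\<close>, the difference has modular at least
  \<open>\<epsilon>\<^sup>b = 4\<eta>\<close>. Integrating the pointwise inequality with this \<open>\<eta>\<close> bounds the modular of the midpoint by
  \<open>(1/2 + c\<eta>) \<sqdot> 2 - 4c\<eta> = 1 - 2c\<eta>\<close>, which the upper bound on the exponent turns into a bound on the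
  norm.\<close>

lemma uniformly_convex_if_exponent_bounds:
  assumes [measurable]: "p \<in> borel_measurable M"
    and a: "1 < a"
    and ae: "AE x in M. a \<le> real_of_ereal (p x) \<and> real_of_ereal (p x) \<le> b"
  shows "uniformly_convex (var_exp_lebesgue M p)"
  unfolding var_exp_lebesgue_def uniformly_convex_orlicz_space_iff
proof (intro allI impI)
  let ?\<rho> = "modular M (var_exp_phi p)" and ?N = "luxemburg_norm M (var_exp_phi p)"
  let ?L = "orlicz_functions M (var_exp_phi p)"
  \<comment> \<open>On a null space \<open>b\<close> could be negative, whereas the roots and limits below need a positive exponent.\<close>
  define b' where "b' = max 1 b"
  have b': "1 \<le> b'" "b \<le> b'" by (auto simp: b'_def)
  have ae1: "AE x in M. 1 \<le> real_of_ereal (p x)"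
    using ae by eventually_elim (use a in auto)
  have shrink: "ennreal (c powr b') * ?\<rho> f \<le> ?\<rho> (\<lambda>x. of_real c * f x)"
    if "f \<in> borel_measurable M" "0 < c" "c \<le> 1" for f c
  proof (rule modular_scale_ge)
    show "AE x in M. f x \<noteq> 0 \<longrightarrow> 1 \<le> real_of_ereal (p x) \<and> c powr b' \<le> c powr real_of_ereal (p x)"
      using ae by eventually_elim (use a b' that in \<open>auto intro!: powr_mono'\<close>)
  qed (use that assms in auto)
  \<comment> \<open>Norm at most 1 only says that \<open>\<rho> (c f) \<le> 1\<close> for all \<open>c < 1\<close>. Since \<open>c\<^sup>b \<rho> f \<le> \<rho> (c f)\<close>, letting
    \<open>c \<rightarrow> 1\<close> recovers \<open>\<rho> f \<le> 1\<close>.\<close>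
  have modular_le_1: "?\<rho> f \<le> 1" if f: "f \<in> ?L" "?N f \<le> 1" for f
  proof -
    have [measurable]: "f \<in> borel_measurable M" using f by (auto simp: orlicz_functions_def)
    have *: "ennreal (c powr b') * ?\<rho> f \<le> 1" if c: "0 < c" "c < 1" for c
    proof -
      have "1 < 1 / c" using c by simp
      then have "?N f < 1 / c" using f by linarith
      then obtain l where l: "0 < l" "?\<rho> (\<lambda>x. f x / of_real l) \<le> 1" "l < 1 / c"
        using luxemburg_norm_set_nonempty[OF assms(1) f(1) ae1] that
          cInf_lessD[of "{l. 0 < l \<and> ?\<rho> (\<lambda>x. f x / of_real l) \<le> 1}" "1 / c"]
        unfolding luxemburg_norm_def by blast
      have d: "1 \<le> 1 / (c * l)" using l c by (simp add: field_simps)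
      have "?\<rho> (\<lambda>x. of_real c * f x) \<le> ennreal (1 / (c * l)) * ?\<rho> (\<lambda>x. of_real c * f x)"
        using mult_right_mono[of 1 "ennreal (1 / (c * l))" "?\<rho> (\<lambda>x. of_real c * f x)"] d by simp
      also have "\<dots> \<le> ?\<rho> (\<lambda>x. of_real (1 / (c * l)) * (of_real c * f x))"
        using d ae1 by (intro modular_superhomogeneous) auto
      also have "(\<lambda>x. of_real (1 / (c * l)) * (of_real c * f x)) = (\<lambda>x. f x / of_real l)"
        using c l by (auto simp: field_simps)
      also note l(2)
      finally have "?\<rho> (\<lambda>x. of_real c * f x) \<le> 1" .
      then show ?thesis using shrink[of f c] c by (auto intro: order_trans)
    qed
    show ?thesis
    proof (rule LIMSEQ_le_const2)
      have "(\<lambda>n. (real n / real (Suc n)) powr b') \<longlonglongrightarrow> 1 powr b'"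
        by (intro tendsto_powr LIMSEQ_n_over_Suc_n tendsto_const) auto
      then have "(\<lambda>n. ennreal ((real n / real (Suc n)) powr b') * ?\<rho> f) \<longlonglongrightarrow> ennreal (1 powr b') * ?\<rho> f"
        by (intro tendsto_mult_ennreal tendsto_ennrealI tendsto_const) auto
      then show "(\<lambda>n. ennreal ((real n / real (Suc n)) powr b') * ?\<rho> f) \<longlonglongrightarrow> ?\<rho> f" by simp
      show "\<exists>N. \<forall>n\<ge>N. ennreal ((real n / real (Suc n)) powr b') * ?\<rho> f \<le> 1"
        by (intro exI[of _ 1] allI impI *) (auto simp: field_simps)
    qed
  qed
  fix \<epsilon> :: real assume \<epsilon>: "0 < \<epsilon> \<and> \<epsilon> < 1"
  define \<eta> where "\<eta> = \<epsilon> powr b' / 4"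
  have \<eta>: "0 < \<eta>" "4 * \<eta> = \<epsilon> powr b'" using \<epsilon> by (auto simp: \<eta>_def)
  obtain c where c: "0 < c"
    and ineq: "\<And>u v q. a \<le> q \<Longrightarrow> q \<le> b \<Longrightarrow> cmod ((u + v) / 2) powr q + c * cmod (u - v) powr q
         \<le> (1/2 + c * \<eta>) * (cmod u powr q + cmod v powr q)"
    using powr_norm_uniformly_convex[OF a \<eta>(1)] by metis
  \<comment> \<open>\<open>l\<^sup>b\<close> should be \<open>1 - 2c\<eta>\<close>; the maximum with \<open>1/2\<close> keeps the base of the root positive.\<close>
  define l where "l = (max (1/2) (1 - 2 * c * \<eta>)) powr (1 / b')"
  have l: "0 < l" "l < 1" "1 - 2 * c * \<eta> \<le> l powr b'"
  proof -
    show "0 < l" by (auto simp: l_def)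
    show "l < 1" unfolding l_def using c \<eta> b' powr_less_mono2[of "1 / b'" "max (1/2) (1 - 2 * c * \<eta>)" 1] by auto
    show "1 - 2 * c * \<eta> \<le> l powr b'" using b' by (simp add: l_def powr_powr)
  qed
  show "\<exists>\<delta>>0. \<forall>f\<in>?L. \<forall>g\<in>?L. ?N f \<le> 1 \<longrightarrow> ?N g \<le> 1 \<longrightarrow> \<epsilon> < ?N (\<lambda>x. f x - g x) \<longrightarrow>
      ?N (\<lambda>x. (f x + g x) / 2) < 1 - \<delta>"
  proof (intro exI[of _ "(1 - l) / 2"] conjI ballI impI)
    fix f g assume fg: "f \<in> ?L" "g \<in> ?L" "?N f \<le> 1" "?N g \<le> 1" "\<epsilon> < ?N (\<lambda>x. f x - g x)"
    have [measurable]: "f \<in> borel_measurable M" "g \<in> borel_measurable M"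
      using fg by (auto simp: orlicz_functions_def)
    let ?h = "\<lambda>x. (f x + g x) / 2" and ?d = "\<lambda>x. f x - g x"
    have d: "ennreal (4 * \<eta>) \<le> ?\<rho> ?d"
    proof -
      have "1 \<le> ?\<rho> (\<lambda>x. ?d x / of_real \<epsilon>)"
        using luxemburg_norm_le[of \<epsilon> M "var_exp_phi p" ?d] fg(5) \<epsilon>
        by (metis linear not_le)
      then have "ennreal (\<epsilon> powr b') * 1 \<le> ennreal (\<epsilon> powr b') * ?\<rho> (\<lambda>x. ?d x / of_real \<epsilon>)"
        by (intro mult_left_mono) auto
      also have "\<dots> \<le> ?\<rho> (\<lambda>x. of_real \<epsilon> * (?d x / of_real \<epsilon>))"
        using \<epsilon> by (intro shrink) auto
      also have "(\<lambda>x. of_real \<epsilon> * (?d x / of_real \<epsilon>)) = ?d" using \<epsilon> by auto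
      finally show ?thesis by (simp add: \<eta>(2))
    qed
    have "?\<rho> ?h + ennreal c * ?\<rho> ?d
        = (\<integral>\<^sup>+ x. ennreal (var_exp_phi p x (cmod (?h x))) +
                  ennreal c * ennreal (var_exp_phi p x (cmod (?d x))) \<partial>M)"
      unfolding modular_def by (simp add: nn_integral_add nn_integral_cmult)
    also have "\<dots> \<le> (\<integral>\<^sup>+ x. ennreal (1/2 + c * \<eta>) *
        (ennreal (var_exp_phi p x (cmod (f x))) + ennreal (var_exp_phi p x (cmod (g x)))) \<partial>M)"
    proof (rule nn_integral_mono_AE, use ae in eventually_elim)
      fix x assume x: "a \<le> real_of_ereal (p x) \<and> real_of_ereal (p x) \<le> b"
      let ?q = "real_of_ereal (p x)"
      have "0 < ?q" using x a by auto
      then have "var_exp_phi p x (cmod (?h x)) + c * var_exp_phi p x (cmod (?d x))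
        \<le> (1/2 + c * \<eta>) * (var_exp_phi p x (cmod (f x)) + var_exp_phi p x (cmod (g x)))"
        using divide_right_mono[OF ineq[of ?q "f x" "g x"], of ?q] x
        by (simp only: var_exp_phi_def add_divide_distrib[symmetric] times_divide_eq_right)
      then show "ennreal (var_exp_phi p x (cmod (?h x))) +
            ennreal c * ennreal (var_exp_phi p x (cmod (?d x)))
          \<le> ennreal (1/2 + c * \<eta>) *
            (ennreal (var_exp_phi p x (cmod (f x))) + ennreal (var_exp_phi p x (cmod (g x))))"
        using c \<eta> \<open>0 < ?q\<close>
        by (simp add: var_exp_phi_def flip: ennreal_plus ennreal_mult)
    qed
    also have "\<dots> = ennreal (1/2 + c * \<eta>) * (?\<rho> f + ?\<rho> g)"
      unfolding modular_def by (simp add: nn_integral_add nn_integral_cmult)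
    also have "\<dots> \<le> ennreal (1/2 + c * \<eta>) * (1 + 1)"
      using fg by (intro mult_left_mono add_mono modular_le_1) auto
    also have "\<dots> = ennreal (1/2 + c * \<eta>) * ennreal 2" by simp
    also have "\<dots> = ennreal ((1/2 + c * \<eta>) * 2)"
      using c \<eta> by (intro ennreal_mult[symmetric]) auto
    also have "(1/2 + c * \<eta>) * 2 = 1 + 2 * (c * \<eta>)" by (simp add: algebra_simps)
    finally have upper: "?\<rho> ?h + ennreal c * ?\<rho> ?d \<le> ennreal (1 + 2 * (c * \<eta>))" .
    have "?\<rho> ?h + ennreal (4 * (c * \<eta>)) = ?\<rho> ?h + ennreal c * ennreal (4 * \<eta>)"
      using c \<eta> by (simp add: field_simps flip: ennreal_mult)
    also have "\<dots> \<le> ennreal (1 + 2 * (c * \<eta>))"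
      using upper d by (meson add_left_mono mult_left_mono order_trans zero_le)
    finally have le: "?\<rho> ?h + ennreal (4 * (c * \<eta>)) \<le> ennreal (1 + 2 * (c * \<eta>))" .
    then obtain r where r: "?\<rho> ?h = ennreal r" "0 \<le> r"
      by (cases "?\<rho> ?h") (auto simp: top_unique)
    have "r + 4 * (c * \<eta>) \<le> 1 + 2 * (c * \<eta>)"
      using le r c \<eta> by (simp flip: ennreal_plus)
    then have "r \<le> l powr b'" using l(3) by (simp add: algebra_simps)
    then have "?\<rho> ?h \<le> ennreal (l powr b')" using r by (simp add: ennreal_leI)
    moreover have "ennreal (l powr b') * ?\<rho> (\<lambda>x. ?h x / of_real l) \<le> ?\<rho> (\<lambda>x. of_real l * (?h x / of_real l))"
      using l by (intro shrink) auto
    moreover have "(\<lambda>x. of_real l * (?h x / of_real l)) = ?h" using l by auto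
    ultimately have "ennreal (l powr b') * ?\<rho> (\<lambda>x. ?h x / of_real l) \<le> ennreal (l powr b') * 1"
      by simp
    then have "?\<rho> (\<lambda>x. ?h x / of_real l) \<le> 1"
      using l by (subst (asm) ennreal_mult_le_mult_iff) auto
    then have "?N ?h \<le> l" using l by (intro luxemburg_norm_le) auto
    then show "?N ?h < 1 - (1 - l) / 2" using l by (simp add: field_simps)
  qed (use l in auto)
qed

section \<open>Normalised functions with disjoint supports\<close>

lemma disjoint_finite_subsets:
  assumes "sigma_finite_measure M" "non_atomic M" "S \<in> sets M" "0 < emeasure M S"
  obtains B C where "B \<in> sets M" "C \<in> sets M" "B \<subseteq> S" "C \<subseteq> S" "B \<inter> C = {}"
    "0 < emeasure M B" "emeasure M B < \<infinity>" "0 < emeasure M C" "emeasure M C < \<infinity>"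
proof -
  obtain A where A: "A \<in> sets M" "A \<subseteq> S" "0 < emeasure M A" "emeasure M A < \<infinity>"
  proof (cases "emeasure M S = \<infinity>")
    case True
    then show ?thesis
      using sigma_finite_measure.approx_PInf_emeasure_with_finite[OF assms(1,3), of 0] that
      by (metis ennreal_0)
  next
    case False
    then show ?thesis using that[of S] assms by (simp add: less_top)
  qed
  obtain B where B: "B \<in> sets M" "B \<subseteq> A" "0 < emeasure M B" "emeasure M B < emeasure M A"
    using assms(2) A unfolding non_atomic_def by metis
  have fin: "emeasure M B < \<infinity>" using B A by (meson order_less_trans)
  have diff: "emeasure M (A - B) = emeasure M A - emeasure M B"
    using A B fin by (intro emeasure_Diff) auto
  show ?thesis
  proof (rule that[of B "A - B"])
    show "0 < emeasure M (A - B)" using B by (simp add: diff diff_gr0_ennreal)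
    show "emeasure M (A - B) < \<infinity>"
      using A(4) emeasure_mono[of "A - B" A M] A(1) by (auto intro: le_less_trans)
  qed (use A B fin in auto)
qed

text \<open>The function \<open>e = (q / \<mu>(B))\<^bsup>1/q\<^esup>\<close> on \<open>B\<close> has the constant integrand \<open>e\<^sup>q / q = 1 / \<mu>(B)\<close>. This also works
  for unbounded exponents, where rescaling an arbitrary function to modular 1 may be impossible.\<close>

lemma exists_modular_eq_1:
  assumes [measurable]: "p \<in> borel_measurable M" "B \<in> sets M"
    and B: "0 < emeasure M B" "emeasure M B < \<infinity>"
    and q: "\<And>x. x \<in> B \<Longrightarrow> 1 \<le> real_of_ereal (p x)"
  obtains e where "e \<in> borel_measurable M" "\<And>x. x \<notin> B \<Longrightarrow> e x = 0"
    "modular M (var_exp_phi p) e = 1"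
proof -
  let ?q = "\<lambda>x. real_of_ereal (p x)"
  define m where "m = measure M B"
  have m: "emeasure M B = ennreal m"
    unfolding m_def using B(2) by (intro emeasure_eq_ennreal_measure) auto
  moreover from this have "0 < m" using B(1) by simp
  ultimately have m: "emeasure M B = ennreal m" "0 < m" by blast+
  define e :: "'a \<Rightarrow> complex" where
    "e = (\<lambda>x. if x \<in> B then of_real ((?q x / m) powr (1 / ?q x)) else 0)"
  show ?thesis
  proof
    show "e \<in> borel_measurable M" unfolding e_def by measurable
    show "e x = 0" if "x \<notin> B" for x using that by (simp add: e_def)
    have "ennreal (var_exp_phi p x (cmod (e x))) = ennreal (1 / m) * indicator B x" for x
    proof (cases "x \<in> B")
      case True
      have "((r / m) powr (1 / r)) powr r / r = 1 / m" if "1 \<le> r" for r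
        using that m by (simp add: powr_powr)
      from this[OF q[OF True]] show ?thesis using True by (simp add: var_exp_phi_def e_def)
    qed (simp add: var_exp_phi_def e_def)
    then have "modular M (var_exp_phi p) e = ennreal (1 / m) * emeasure M B"
      unfolding modular_def by (simp add: nn_integral_cmult_indicator)
    also have "\<dots> = 1" using m by (simp flip: ennreal_mult)
    finally show "modular M (var_exp_phi p) e = 1" .
  qed
qed

lemma exists_disjoint_modular_eq_1:
  assumes "sigma_finite_measure M" "non_atomic M" "S \<in> sets M" "0 < emeasure M S"
    and p: "p \<in> borel_measurable M" and q: "\<And>x. x \<in> S \<Longrightarrow> 1 \<le> real_of_ereal (p x)"
  obtains e f where "e \<in> borel_measurable M" "f \<in> borel_measurable M"
    "\<And>x. e x = 0 \<or> f x = 0" "\<And>x. e x \<noteq> 0 \<or> f x \<noteq> 0 \<Longrightarrow> x \<in> S"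
    "modular M (var_exp_phi p) e = 1" "modular M (var_exp_phi p) f = 1"
proof -
  obtain B C where BC: "B \<in> sets M" "C \<in> sets M" "B \<subseteq> S" "C \<subseteq> S" "B \<inter> C = {}"
    "0 < emeasure M B" "emeasure M B < \<infinity>" "0 < emeasure M C" "emeasure M C < \<infinity>"
    using disjoint_finite_subsets[OF assms(1-4)] by metis
  obtain e where e: "e \<in> borel_measurable M" "\<And>x. x \<notin> B \<Longrightarrow> e x = 0"
    "modular M (var_exp_phi p) e = 1"
    using exists_modular_eq_1[OF p BC(1,6,7)] q BC(3) by blast
  obtain f where f: "f \<in> borel_measurable M" "\<And>x. x \<notin> C \<Longrightarrow> f x = 0"
    "modular M (var_exp_phi p) f = 1"
    using exists_modular_eq_1[OF p BC(2,8,9)] q BC(4) by blast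
  show ?thesis
  proof (rule that[of e f])
    show "e x = 0 \<or> f x = 0" for x using e(2) f(2) BC(5) by blast
    show "x \<in> S" if "e x \<noteq> 0 \<or> f x \<noteq> 0" for x using that e(2) f(2) BC(3,4) by blast
  qed (use e f in simp_all)
qed

section \<open>Uniform convexity bounds the exponent\<close>

text \<open>For \<open>c < 1\<close> choose \<open>n\<close> with \<open>c\<^sup>n < 1/2\<close>. Where \<open>q \<ge> n\<close>, shrinking by \<open>c\<close> at least halves the modular, so
  that \<open>c (e + f)\<close> and \<open>c (e - f)\<close> stay in the unit ball, whereas their midpoint \<open>c e\<close> has norm at least
  \<open>c\<close> and their difference \<open>2 c f\<close> has norm at least \<open>2 c\<close>.\<close>

lemma not_uniformly_convex_if_exponent_unbounded:
  assumes M: "sigma_finite_measure M" "non_atomic M" and p: "p \<in> borel_measurable M"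
    and fin: "AE x in M. 1 \<le> p x \<and> p x < \<infinity>"
    and unb: "\<And>r. \<not> (AE x in M. p x \<le> ereal r)"
  shows "\<not> uniformly_convex (var_exp_lebesgue M p)"
proof
  let ?\<rho> = "modular M (var_exp_phi p)" and ?N = "luxemburg_norm M (var_exp_phi p)"
  note [measurable] = p
  have ae1: "AE x in M. 1 \<le> real_of_ereal (p x)"
    using fin by eventually_elim (simp add: one_le_real_of_ereal)
  assume "uniformly_convex (var_exp_lebesgue M p)"
  from this[unfolded var_exp_lebesgue_def uniformly_convex_orlicz_space_iff, rule_format, of "1/2"]
  obtain \<delta> where \<delta>: "0 < \<delta>" and uc: "\<And>f g. f \<in> orlicz_functions M (var_exp_phi p) \<Longrightarrow>
      g \<in> orlicz_functions M (var_exp_phi p) \<Longrightarrow> ?N f \<le> 1 \<Longrightarrow> ?N g \<le> 1 \<Longrightarrow>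
      1/2 < ?N (\<lambda>x. f x - g x) \<Longrightarrow> ?N (\<lambda>x. (f x + g x) / 2) < 1 - \<delta>"
    by auto
  define c where "c = max (1/2) (1 - \<delta>)"
  have c: "1/2 \<le> c" "1 - \<delta> \<le> c" "c < 1" using \<delta> by (auto simp: c_def)
  obtain n where n: "c ^ n < 1/2" using real_arch_pow_inv[of "1/2" c] c by auto
  define S where "S = {x \<in> space M. ereal (real n) < p x \<and> 1 \<le> p x \<and> p x < \<infinity>}"
  have [measurable]: "S \<in> sets M" unfolding S_def by measurable
  have S: "1 \<le> real_of_ereal (p x)" "real n \<le> real_of_ereal (p x)" if "x \<in> S" for x
    using that by (cases "p x"; auto simp: S_def)+
  have "emeasure M S \<noteq> 0"
  proof
    assume "emeasure M S = 0"
    then have "AE x in M. x \<notin> S" by (intro AE_not_in) (auto simp: null_sets_def)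
    then have "AE x in M. p x \<le> ereal (real n)"
      using fin AE_space by eventually_elim (auto simp: S_def not_less)
    with unb show False by blast
  qed
  then obtain e f where [measurable]: "e \<in> borel_measurable M" "f \<in> borel_measurable M"
    and disj: "\<And>x. e x = 0 \<or> f x = 0" and supp: "\<And>x. e x \<noteq> 0 \<or> f x \<noteq> 0 \<Longrightarrow> x \<in> S"
    and one: "?\<rho> e = 1" "?\<rho> f = 1"
    using exists_disjoint_modular_eq_1[OF M, of S p] S(1) p by (auto simp: zero_less_iff_neq_zero)
  have half: "?\<rho> (\<lambda>x. of_real c * g x) \<le> ennreal (1/2)"
    if [measurable]: "g \<in> borel_measurable M" and g: "\<And>x. g x \<noteq> 0 \<Longrightarrow> x \<in> S" "?\<rho> g = 1" for g
  proof -
    have "c powr real_of_ereal (p x) \<le> 1/2" if "x \<in> S" for x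
    proof -
      have "c powr real_of_ereal (p x) \<le> c powr real n"
        using c S(2)[OF that] by (intro powr_mono') auto
      then show ?thesis using n c by (simp add: powr_realpow)
    qed
    then have "?\<rho> (\<lambda>x. of_real c * g x) \<le> ennreal (1/2) * ?\<rho> g"
      using c g S by (intro modular_scale_le AE_I2) auto
    then show ?thesis by (simp add: g)
  qed
  have neg: "?\<rho> (\<lambda>x. - g x) = ?\<rho> g" for g by (simp add: modular_def)
  let ?f = "\<lambda>x. of_real c * e x + of_real c * f x"
  let ?g = "\<lambda>x. of_real c * e x + of_real c * (- f x)"
  have "?\<rho> ?f \<le> ennreal (1/2) + ennreal (1/2)"
    using disj supp one
    by (subst modular_add_disjoint) (auto intro!: add_mono half simp del: ennreal_half)
  moreover have "?\<rho> ?g \<le> ennreal (1/2) + ennreal (1/2)"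
    using disj supp one
    by (subst modular_add_disjoint) (auto intro!: add_mono half simp: neg simp del: ennreal_half mult_minus_right)
  moreover have "ennreal (1/2) + ennreal (1/2) = 1" using ennreal_plus[of "1/2" "1/2"] by simp
  ultimately have le1: "?\<rho> ?f \<le> 1" "?\<rho> ?g \<le> 1" by auto
  have mem: "g \<in> orlicz_functions M (var_exp_phi p)"
    if "g \<in> borel_measurable M" "?\<rho> g \<le> 1" for g
    using that by (intro orlicz_functionsI) (auto intro: le_less_trans)
  have scaled_le_1: "?\<rho> (\<lambda>x. of_real c * g x) \<le> 1"
    if "g \<in> borel_measurable M" "\<And>x. g x \<noteq> 0 \<Longrightarrow> x \<in> S" "?\<rho> g = 1" for g
  proof -
    have "ennreal (1/2) \<le> 1" by (subst ennreal_le_1) simp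
    with half[OF that] show ?thesis by (rule order_trans)
  qed
  have h: "c \<le> ?N (\<lambda>x. of_real c * g x)"
    if [measurable]: "g \<in> borel_measurable M" and g: "\<And>x. g x \<noteq> 0 \<Longrightarrow> x \<in> S" "?\<rho> g = 1" for g
  proof (rule luxemburg_norm_ge[OF p _ ae1])
    show "(\<lambda>x. of_real c * g x) \<in> orlicz_functions M (var_exp_phi p)"
      using scaled_le_1[OF that] by (intro mem) auto
    show "1 \<le> ?\<rho> (\<lambda>x. of_real c * g x / of_real c)" using c g by simp
  qed (use c in auto)
  have "?N (\<lambda>x. ?f x - ?g x) > 1/2"
  proof -
    have "2 * c \<le> ?N (\<lambda>x. ?f x - ?g x)"
    proof (rule luxemburg_norm_ge[OF p _ ae1])
      have "(\<lambda>x. of_real (1/2) * (?f x - ?g x)) = (\<lambda>x. of_real c * f x)" by auto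
      then show "(\<lambda>x. ?f x - ?g x) \<in> orlicz_functions M (var_exp_phi p)"
        unfolding orlicz_functions_def using scaled_le_1[of f] supp one
        by (auto intro!: exI[of _ "1/2"] intro: le_less_trans)
      show "1 \<le> ?\<rho> (\<lambda>x. (?f x - ?g x) / of_real (2 * c))" using c one by (simp add: field_simps)
    qed (use c in auto)
    then show ?thesis using c by auto
  qed
  moreover have "?N ?f \<le> 1" "?N ?g \<le> 1" using le1 by (auto intro!: luxemburg_norm_le)
  ultimately have "?N (\<lambda>x. (?f x + ?g x) / 2) < 1 - \<delta>" using le1 by (intro uc mem) auto
  moreover have "(\<lambda>x. (?f x + ?g x) / 2) = (\<lambda>x. of_real c * e x)" by auto
  ultimately show False using h[of e] supp one c by auto
qed

text \<open>Where \<open>q\<close> is at most \<open>r\<close> with \<open>(1/2)\<^sup>r = c/2\<close>, halving a function of modular 1 leaves modular at least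
  \<open>c/2\<close>. The two disjoint halves of \<open>(e + f) / 2\<close> therefore add up to modular at least \<open>c\<close>, and the norm
  is at least \<open>c\<close> as well.\<close>

lemma not_uniformly_convex_if_exponent_near_1:
  assumes M: "sigma_finite_measure M" "non_atomic M" and p: "p \<in> borel_measurable M"
    and fin: "AE x in M. 1 \<le> p x \<and> p x < \<infinity>"
    and near: "\<And>r. 1 < r \<Longrightarrow> \<not> (AE x in M. ereal r \<le> p x)"
  shows "\<not> uniformly_convex (var_exp_lebesgue M p)"
proof
  let ?\<rho> = "modular M (var_exp_phi p)" and ?N = "luxemburg_norm M (var_exp_phi p)"
  note [measurable] = p
  have ae1: "AE x in M. 1 \<le> real_of_ereal (p x)"
    using fin by eventually_elim (simp add: one_le_real_of_ereal)
  assume "uniformly_convex (var_exp_lebesgue M p)"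
  from this[unfolded var_exp_lebesgue_def uniformly_convex_orlicz_space_iff, rule_format, of "1/2"]
  obtain \<delta> where \<delta>: "0 < \<delta>" and uc: "\<And>f g. f \<in> orlicz_functions M (var_exp_phi p) \<Longrightarrow>
      g \<in> orlicz_functions M (var_exp_phi p) \<Longrightarrow> ?N f \<le> 1 \<Longrightarrow> ?N g \<le> 1 \<Longrightarrow>
      1/2 < ?N (\<lambda>x. f x - g x) \<Longrightarrow> ?N (\<lambda>x. (f x + g x) / 2) < 1 - \<delta>"
    by auto
  define c where "c = max (1/2) (1 - \<delta>)"
  have c: "1/2 \<le> c" "1 - \<delta> \<le> c" "c < 1" using \<delta> by (auto simp: c_def)
  define r where "r = 1 + log 2 (1 / c)"
  have r: "1 < r" "(1/2) powr r = c / 2"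
  proof -
    show "1 < r" using c by (simp add: r_def)
    have "2 powr r = 2 / c" using c by (simp add: r_def powr_add)
    then show "(1/2) powr r = c / 2" by (simp add: powr_divide)
  qed
  define S where "S = {x \<in> space M. p x < ereal r \<and> 1 \<le> p x}"
  have [measurable]: "S \<in> sets M" unfolding S_def by measurable
  have S: "1 \<le> real_of_ereal (p x)" "real_of_ereal (p x) \<le> r" if "x \<in> S" for x
    using that by (cases "p x"; auto simp: S_def)+
  have "emeasure M S \<noteq> 0"
  proof
    assume "emeasure M S = 0"
    then have "AE x in M. x \<notin> S" by (intro AE_not_in) (auto simp: null_sets_def)
    then have "AE x in M. ereal r \<le> p x"
      using fin AE_space by eventually_elim (auto simp: S_def not_less)
    with near r show False by blast
  qed
  then obtain e f where [measurable]: "e \<in> borel_measurable M" "f \<in> borel_measurable M"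
    and disj: "\<And>x. e x = 0 \<or> f x = 0" and supp: "\<And>x. e x \<noteq> 0 \<or> f x \<noteq> 0 \<Longrightarrow> x \<in> S"
    and one: "?\<rho> e = 1" "?\<rho> f = 1"
    using exists_disjoint_modular_eq_1[OF M, of S p] S(1) p by (auto simp: zero_less_iff_neq_zero)
  have half: "ennreal (c / 2) \<le> ?\<rho> (\<lambda>x. of_real (1/2) * g x)"
    if [measurable]: "g \<in> borel_measurable M" and g: "\<And>x. g x \<noteq> 0 \<Longrightarrow> x \<in> S" "?\<rho> g = 1" for g
  proof -
    have "c / 2 \<le> (1/2) powr real_of_ereal (p x)" if "x \<in> S" for x
      using powr_mono'[OF S(2)[OF that], of "1/2"] r by simp
    then have "ennreal (c / 2) * ?\<rho> g \<le> ?\<rho> (\<lambda>x. of_real (1/2) * g x)"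
      using c g S by (intro modular_scale_ge AE_I2) auto
    then show ?thesis by (simp add: g)
  qed
  have sum: "?\<rho> (\<lambda>x. e x + f x) = 2"
    using disj by (subst modular_add_disjoint) (auto simp: one)
  have diff: "?\<rho> (\<lambda>x. e x - f x) = 2"
  proof -
    have "?\<rho> (\<lambda>x. e x + (- f x)) = ?\<rho> e + ?\<rho> (\<lambda>x. - f x)"
      using disj by (intro modular_add_disjoint) auto
    moreover have "?\<rho> (\<lambda>x. - f x) = ?\<rho> f" by (simp add: modular_def)
    ultimately show ?thesis by (simp add: one)
  qed
  have half_le: "?\<rho> (\<lambda>x. (e x + f x) / 2) \<le> 2"
  proof -
    have "?\<rho> (\<lambda>x. of_real (1/2) * (e x + f x)) \<le> ennreal 1 * ?\<rho> (\<lambda>x. e x + f x)"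
    proof (rule modular_scale_le)
      show "AE x in M. e x + f x \<noteq> 0 \<longrightarrow>
          1 \<le> real_of_ereal (p x) \<and> (1/2) powr real_of_ereal (p x) \<le> 1"
        using ae1 by eventually_elim (simp add: powr_le1)
    qed auto
    then show ?thesis by (simp add: sum)
  qed
  have mem: "g \<in> orlicz_functions M (var_exp_phi p)"
    if "g \<in> borel_measurable M" "?\<rho> g \<le> 2" for g
    using that by (intro orlicz_functionsI) (auto intro: le_less_trans)
  have "ennreal c = ennreal (c / 2) + ennreal (c / 2)" using c by (simp flip: ennreal_plus)
  also have "\<dots> \<le> ?\<rho> (\<lambda>x. of_real (1/2) * e x) + ?\<rho> (\<lambda>x. of_real (1/2) * f x)"
    using supp one by (intro add_mono half) auto
  also have "\<dots> = ?\<rho> (\<lambda>x. of_real (1/2) * e x + of_real (1/2) * f x)"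
    using disj by (subst modular_add_disjoint) auto
  also have "(\<lambda>x. of_real (1/2) * e x + of_real (1/2) * f x) = (\<lambda>x. (e x + f x) / 2)"
    by (auto simp: field_simps)
  finally have mid: "ennreal c \<le> ?\<rho> (\<lambda>x. (e x + f x) / 2)" .
  have "c \<le> ?N (\<lambda>x. (e x + f x) / 2)"
  proof (rule luxemburg_norm_ge[OF p _ ae1])
    show "(\<lambda>x. (e x + f x) / 2) \<in> orlicz_functions M (var_exp_phi p)"
      using half_le by (intro mem) auto
    have "1 = ennreal (1 / c) * ennreal c" using c by (simp flip: ennreal_mult)
    also have "\<dots> \<le> ennreal (1 / c) * ?\<rho> (\<lambda>x. (e x + f x) / 2)"
      using mid by (intro mult_left_mono) auto
    also have "\<dots> \<le> ?\<rho> (\<lambda>x. of_real (1 / c) * ((e x + f x) / 2))"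
      using ae1 c by (intro modular_superhomogeneous) auto
    finally show "1 \<le> ?\<rho> (\<lambda>x. (e x + f x) / 2 / of_real c)" by (simp add: mult.commute)
  qed (use c in auto)
  moreover have "1 \<le> ?N (\<lambda>x. e x - f x)"
    by (rule luxemburg_norm_ge[OF p _ ae1]) (auto simp: diff intro!: mem)
  moreover have "?N e \<le> 1" "?N f \<le> 1" by (auto intro!: luxemburg_norm_le simp: one)
  moreover have "e \<in> orlicz_functions M (var_exp_phi p)" "f \<in> orlicz_functions M (var_exp_phi p)"
    using one by (simp_all add: mem)
  ultimately show False using uc[of e f] c by auto
qed

section \<open>The characterisation of uniform convexity\<close>

text \<open>Negating the two criteria for failure yields real bounds \<open>r > 1\<close> and \<open>s\<close> for the exponent almost
  everywhere. Conversely, strict inequalities for the essential bounds leave room for real \<open>a > 1\<close>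
  and \<open>b\<close> in between.\<close>

theorem corollary6p5:
  fixes M :: "'a measure" and p :: "'a \<Rightarrow> ereal"
  assumes "sigma_finite_measure M"
    and "complete_measure M"
    and "emeasure M (space M) \<noteq> 0"
    and "non_atomic M"
    and "separable_measure M"
    and "p \<in> borel_measurable M"
    and "AE x in M. 1 \<le> p x \<and> p x < \<infinity>"
  shows "uniformly_convex (var_exp_lebesgue M p) \<longleftrightarrow>
    1 < essinf M p \<and> essinf M p \<le> esssup M p \<and> esssup M p < \<infinity>"
proof
  assume uc: "uniformly_convex (var_exp_lebesgue M p)"
  obtain r where r: "1 < r" "AE x in M. ereal r \<le> p x"
    using not_uniformly_convex_if_exponent_near_1[OF assms(1,4,6,7)] uc by blast
  obtain s where s: "AE x in M. p x \<le> ereal s"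
    using not_uniformly_convex_if_exponent_unbounded[OF assms(1,4,6,7)] uc by blast
  have "1 < ereal r" using r by simp
  also have "\<dots> \<le> essinf M p" unfolding essinf_def using r by (intro Sup_upper) auto
  finally have "1 < essinf M p" .
  moreover have "essinf M p \<le> esssup M p"
    unfolding essinf_def
  proof (rule Sup_least)
    fix z assume "z \<in> {z. AE x in M. z \<le> p x}"
    then have "AE x in M. z \<le> p x" by simp
    with esssup_AE[of p M] have "AE x in M. z \<le> esssup M p"
      by eventually_elim (rule order_trans)
    then show "z \<le> esssup M p"
      using assms(3) by (simp add: eventually_const_iff ae_filter_eq_bot_iff)
  qed
  moreover have "esssup M p \<le> ereal s" using assms(6) s by (rule esssup_I)
  then have "esssup M p < \<infinity>" by (rule le_less_trans) simp
  ultimately show "1 < essinf M p \<and> essinf M p \<le> esssup M p \<and> esssup M p < \<infinity>" by blast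
next
  assume bounds: "1 < essinf M p \<and> essinf M p \<le> esssup M p \<and> esssup M p < \<infinity>"
  obtain a where a: "1 < ereal a" "ereal a < essinf M p"
    using bounds ereal_dense2 by blast
  obtain b where b: "esssup M p < ereal b"
    using bounds ereal_dense2 by blast
  obtain z where z: "ereal a < z" "AE x in M. z \<le> p x"
    using a(2) unfolding essinf_def less_Sup_iff by auto
  have "AE x in M. a \<le> real_of_ereal (p x) \<and> real_of_ereal (p x) \<le> b"
    using z(2) esssup_AE[of p M] assms(7)
  proof eventually_elim
    fix x assume "z \<le> p x" "p x \<le> esssup M p" "1 \<le> p x \<and> p x < \<infinity>"
    then have "ereal a < p x" "p x < ereal b" using z(1) b by auto
    then show "a \<le> real_of_ereal (p x) \<and> real_of_ereal (p x) \<le> b" by (cases "p x") auto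
  qed
  then show "uniformly_convex (var_exp_lebesgue M p)"
    using a(1) by (intro uniformly_convex_if_exponent_bounds[OF assms(6)]) auto
qed

end
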